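(* Suppose that $\dot x=\alpha x$, $y=\beta x$ is a completely observable time-invariant linear system, where $x\in\mathbb{R}^n$, $y\in\mathbb{R}^m$ and $\alpha,\beta$ are constant matrices. Then there is a constant $C$ such that for every interval $I$ of integer length and every solution $z$ of $\dot z=\alpha z+f$ in $I$ the following a priori estimate holds: $$\int_I|z|\,dt\le C\left(\int_I|\beta z|\,dt+\int_I|f|\,dt\right),$$ where the constant $C$ does not depend on the interval $I$.
   Context: The system $\dot x=\alpha x$, $y=\beta x$ is completely observable if the knowledge of the curve $y(t)$ in an open time interval allows one to recover $x(t)$ uniquely (i.e. if $\beta x(t)=0$ on an open interval for a solution $x$, then $x=0$). $|\cdot|$ is the Euclidean norm. "Integer length" means a positive integer length; $f$ is an integrable $\mathbb{R}^n$-valued function and $z$ is absolutely continuous. The constant $C$ depends only on $\alpha$ and $\beta$. *)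

theory Defs
  imports "HOL-Analysis.Analysis"
begin

text \<open>
  Absolute continuity of a function on an interval. The library constant
  \<open>absolutely_continuous\<close> is the unrelated notion for measures. A pair \<open>(u, v)\<close> in \<open>D\<close>
  stands for the subinterval with endpoints \<open>u < v\<close>; the subintervals may share endpoints.
\<close>

definition abs_continuous_on :: "real set \<Rightarrow> (real \<Rightarrow> 'a::real_normed_vector) \<Rightarrow> bool" where
  "abs_continuous_on I z \<longleftrightarrow>
     (\<forall>\<epsilon>>0. \<exists>\<delta>>0. \<forall>D.
        finite D \<and> (\<forall>(u, v)\<in>D. u < v \<and> {u..v} \<subseteq> I) \<and>
        pairwise (\<lambda>p q. disjnt {fst p<..<snd p} {fst q<..<snd q}) D \<and>
        (\<Sum>(u, v)\<in>D. v - u) < \<delta>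
        \<longrightarrow> (\<Sum>(u, v)\<in>D. norm (z v - z u)) < \<epsilon>)"

text \<open>Solutions are in the sense of Caratheodory, since the forcing term is only integrable.\<close>

definition solves_forced_on ::
    "real set \<Rightarrow> real^'n^'n \<Rightarrow> (real \<Rightarrow> real^'n) \<Rightarrow> (real \<Rightarrow> real^'n) \<Rightarrow> bool" where
  "solves_forced_on I \<alpha> f z \<longleftrightarrow>
     abs_continuous_on I z \<and>
     (AE t in lebesgue. t \<in> I \<longrightarrow>
        (z has_vector_derivative (\<alpha> *v z t + f t)) (at t within I))"

definition solves_on :: "real set \<Rightarrow> real^'n^'n \<Rightarrow> (real \<Rightarrow> real^'n) \<Rightarrow> bool" where
  "solves_on T \<alpha> x \<longleftrightarrow>
     (\<forall>t\<in>T. (x has_vector_derivative (\<alpha> *v x t)) (at t within T))"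

text \<open>
  On every open time interval, however short, the output curve determines the state curve.
\<close>

definition completely_observable :: "real^'n^'n \<Rightarrow> real^'n^'m \<Rightarrow> bool" where
  "completely_observable \<alpha> \<beta> \<longleftrightarrow>
     (\<forall>a b x1 x2. a < b \<and>
        solves_on {a<..<b} \<alpha> x1 \<and> solves_on {a<..<b} \<alpha> x2 \<and>
        (\<forall>t\<in>{a<..<b}. \<beta> *v x1 t = \<beta> *v x2 t)
        \<longrightarrow> (\<forall>t\<in>{a<..<b}. x1 t = x2 t))"

lemma solves_on_diff:
  assumes "solves_on T \<alpha> x1" "solves_on T \<alpha> x2"
  shows "solves_on T \<alpha> (\<lambda>t. x1 t - x2 t)"
  using assms unfolding solves_on_def
  by (auto simp: matrix_vector_mult_diff_distrib intro!: has_vector_derivative_diff)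

text \<open>By linearity, it is enough to distinguish solutions from the zero solution.\<close>

lemma completely_observable_iff_zero_output:
  "completely_observable \<alpha> \<beta> \<longleftrightarrow>
     (\<forall>a b x. a < b \<and> solves_on {a<..<b} \<alpha> x \<and> (\<forall>t\<in>{a<..<b}. \<beta> *v x t = 0)
        \<longrightarrow> (\<forall>t\<in>{a<..<b}. x t = 0))" (is "_ \<longleftrightarrow> ?Z")
proof
  assume L: "completely_observable \<alpha> \<beta>"
  have zero: "solves_on T \<alpha> (\<lambda>_. 0)" for T
    by (simp add: solves_on_def)
  show ?Z
  proof (intro allI impI)
    fix a b x
    assume "a < b \<and> solves_on {a<..<b} \<alpha> x \<and> (\<forall>t\<in>{a<..<b}. \<beta> *v x t = 0)"
    then show "\<forall>t\<in>{a<..<b}. x t = 0"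
      using L[unfolded completely_observable_def, rule_format, of a b x "\<lambda>_. 0"] zero by simp
  qed
next
  assume Z: ?Z
  show "completely_observable \<alpha> \<beta>"
    unfolding completely_observable_def
  proof (intro allI impI)
    fix a b x1 x2
    assume A: "a < b \<and> solves_on {a<..<b} \<alpha> x1 \<and> solves_on {a<..<b} \<alpha> x2 \<and>
      (\<forall>t\<in>{a<..<b}. \<beta> *v x1 t = \<beta> *v x2 t)"
    then have "\<forall>t\<in>{a<..<b}. x1 t - x2 t = 0"
      using Z[rule_format, of a b "\<lambda>t. x1 t - x2 t"]
      by (simp add: solves_on_diff matrix_vector_mult_diff_distrib)
    then show "\<forall>t\<in>{a<..<b}. x1 t = x2 t" by simp
  qed
qed

end

theory Submission
  imports Defs
begin

text \<open>
  Consider first an interval \<open>[s, s + 1]\<close>. Let \<open>x\<close> be the solution of \<open>x' = \<alpha> x\<close> with \<open>x s = z s\<close>, and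
  put \<open>w = z - x\<close>. Then \<open>w\<close> vanishes at \<open>s\<close> and solves the forced equation, so by Gronwall's
  inequality \<open>|w|\<close> is bounded by a constant multiple of the integral of \<open>|f|\<close>
  (\<open>linear_integral_equation_bound\<close>). The free part \<open>x\<close> is determined by the vector \<open>c = z s\<close>, and
  \<open>c \<mapsto> \<integral>\<^sub>0\<^sup>1 |\<beta> exp(t\<alpha>) c| dt\<close> is a seminorm that is definite by observability; on a
  finite-dimensional space it therefore dominates \<open>|c|\<close> (\<open>observability_estimate\<close>). Since
  \<open>|\<beta> x| \<le> |\<beta> z| + |\<beta> w|\<close>, this bounds \<open>|z s|\<close>, hence \<open>x\<close>, and hence \<open>z = x + w\<close>, by the integrals
  of \<open>|\<beta> z|\<close> and \<open>|f|\<close> (\<open>unit_interval_estimate\<close>). The system is time-invariant, so the constant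
  does not depend on \<open>s\<close>, and the estimates for the unit intervals that make up \<open>I\<close> can be added.

  These arguments use the integrated form of the differential equation, which holds because an
  absolutely continuous function is the integral of its almost everywhere derivative
  (\<open>abs_continuous_on_has_integral\<close>). The interval \<open>I\<close> need not be closed; uniform continuity extends
  the solution to the endpoints (\<open>solves_forced_on_integral_equation\<close>).
\<close>

section \<open>Absolutely continuous functions\<close>

lemma abs_continuous_on_subset:
  assumes "abs_continuous_on I z" "J \<subseteq> I"
  shows "abs_continuous_on J z"
  unfolding abs_continuous_on_def
proof (intro allI impI)
  fix e :: real assume "e > 0"
  with assms(1) obtain d where "d > 0" and d: "\<And>D. finite D \<and> (\<forall>(u, v)\<in>D. u < v \<and> {u..v} \<subseteq> I) \<and>
        pairwise (\<lambda>p q. disjnt {fst p<..<snd p} {fst q<..<snd q}) D \<and>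
        (\<Sum>(u, v)\<in>D. v - u) < d \<Longrightarrow> (\<Sum>(u, v)\<in>D. norm (z v - z u)) < e"
    unfolding abs_continuous_on_def by meson
  show "\<exists>d>0. \<forall>D. finite D \<and> (\<forall>(u, v)\<in>D. u < v \<and> {u..v} \<subseteq> J) \<and>
        pairwise (\<lambda>p q. disjnt {fst p<..<snd p} {fst q<..<snd q}) D \<and>
        (\<Sum>(u, v)\<in>D. v - u) < d \<longrightarrow> (\<Sum>(u, v)\<in>D. norm (z v - z u)) < e"
  proof (intro exI[of _ d] conjI allI impI)
    fix D assume D: "finite D \<and> (\<forall>(u, v)\<in>D. u < v \<and> {u..v} \<subseteq> J) \<and>
        pairwise (\<lambda>p q. disjnt {fst p<..<snd p} {fst q<..<snd q}) D \<and> (\<Sum>(u, v)\<in>D. v - u) < d"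
    then have "\<forall>(u, v)\<in>D. u < v \<and> {u..v} \<subseteq> I" using assms(2) by fast
    then show "(\<Sum>(u, v)\<in>D. norm (z v - z u)) < e" using D by (intro d) simp
  qed (rule \<open>d > 0\<close>)
qed

lemma abs_continuous_on_imp_uniformly_continuous_on:
  fixes I :: "real set"
  assumes "abs_continuous_on I z" "is_interval I"
  shows "uniformly_continuous_on I z"
  unfolding uniformly_continuous_on_def
proof (intro allI impI)
  fix e :: real assume "e > 0"
  with assms(1) obtain d where "d > 0" and d: "\<And>D. finite D \<and> (\<forall>(u, v)\<in>D. u < v \<and> {u..v} \<subseteq> I) \<and>
        pairwise (\<lambda>p q. disjnt {fst p<..<snd p} {fst q<..<snd q}) D \<and>
        (\<Sum>(u, v)\<in>D. v - u) < d \<Longrightarrow> (\<Sum>(u, v)\<in>D. norm (z v - z u)) < e"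
    unfolding abs_continuous_on_def by meson
  have lt: "norm (z v - z u) < e" if "u \<in> I" "v \<in> I" "u < v" "v - u < d" for u v
  proof -
    have "{u..v} \<subseteq> I" using assms(2) that(1,2) by (meson atLeastAtMost_iff is_interval_1 subsetI)
    then show ?thesis using d[of "{(u, v)}"] that(3,4) by simp
  qed
  have "dist (z y) (z x) < e" if "x \<in> I" "y \<in> I" "dist y x < d" for x y
  proof (cases x y rule: linorder_cases)
    case less then show ?thesis using lt[of x y] that by (simp add: dist_norm)
  next
    case equal then show ?thesis using \<open>e > 0\<close> by simp
  next
    case greater then show ?thesis using lt[of y x] that by (simp add: dist_norm norm_minus_commute[of "z y"])
  qed
  then show "\<exists>d>0. \<forall>x\<in>I. \<forall>y\<in>I. dist y x < d \<longrightarrow> dist (z y) (z x) < e"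
    using \<open>d > 0\<close> by blast
qed

lemma sum_disjoint_intervals_le_measure:
  fixes D :: "(real \<times> real) set"
  assumes "finite D" and D: "\<And>u v. (u, v) \<in> D \<Longrightarrow> u < v \<and> {u..v} \<subseteq> T"
    and disj: "pairwise (\<lambda>p q. disjnt {fst p<..<snd p} {fst q<..<snd q}) D"
    and "T \<in> lmeasurable"
  shows "(\<Sum>(u, v)\<in>D. v - u) \<le> measure lebesgue T"
proof -
  have "(\<Sum>(u, v)\<in>D. v - u) = (\<Sum>p\<in>D. measure lebesgue {fst p<..<snd p})"
    using D by (intro sum.cong refl) (force simp: measure_lborel_Ioo)
  also have "\<dots> = measure lebesgue (\<Union>p\<in>D. {fst p<..<snd p})"
    by (rule measure_UNION'[symmetric, OF \<open>finite D\<close> _ disj]) auto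
  also have "\<dots> \<le> measure lebesgue T"
    by (rule measure_mono_fmeasurable) (use D assms(4) in \<open>fastforce intro!: sets.finite_UN \<open>finite D\<close>\<close>)+
  finally show ?thesis .
qed

text \<open>
  The Henstock-Kurzweil integral allows a direct proof. At points of differentiability the gauge is
  the one of the classical fundamental theorem. The exceptional null set is covered by an open set of
  small measure, and the gauge keeps the intervals tagged there inside this open set; absolute
  continuity then bounds their total contribution to \<open>z b - z a\<close>.
\<close>

lemma abs_continuous_on_has_integral:
  fixes z :: "real \<Rightarrow> 'a::banach"
  assumes "a < b" and ac: "abs_continuous_on {a..b} z"
    and der: "AE t in lebesgue. t \<in> {a..b} \<longrightarrow> (z has_vector_derivative g t) (at t within {a..b})"
  shows "(g has_integral z b - z a) {a..b}"
proof -
  obtain N where N: "negligible N"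
    and derN: "\<And>t. t \<in> {a..b} - N \<Longrightarrow> (z has_vector_derivative g t) (at t within {a..b})"
    using der by (auto simp: eventually_ae_filter negligible_iff_null_sets)
  \<comment> \<open>Changing the integrand to 0 on the null set removes its terms from the Riemann sums.\<close>
  define h where "h = (\<lambda>t. if t \<in> N then 0 else g t)"
  have "(h has_integral z b - z a) {a..b}"
    unfolding has_integral_factor_content_real
  proof (intro allI impI)
    fix e :: real assume "e > 0"
    let ?e = "e/2"
    have "\<forall>x. \<exists>d>0. x \<in> {a..b} - N \<longrightarrow>
         (\<forall>y\<in>{a..b}. norm (y-x) < d \<longrightarrow> norm (z y - z x - (y-x) *\<^sub>R g x) \<le> ?e * norm (y-x))"
      using derN[unfolded has_vector_derivative_def has_derivative_within_alt] \<open>e > 0\<close>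
      by (meson half_gt_zero zero_less_one)
    then obtain d where d: "\<And>x. 0 < d x"
      "\<And>x y. \<lbrakk>x \<in> {a..b} - N; y \<in> {a..b}; norm (y-x) < d x\<rbrakk>
           \<Longrightarrow> norm (z y - z x - (y-x) *\<^sub>R g x) \<le> ?e * norm (y-x)"
      by metis
    have "?e * (b - a) > 0" using \<open>e > 0\<close> \<open>a < b\<close> by simp
    with ac obtain \<delta> where "\<delta> > 0" and \<delta>: "\<And>D. finite D \<and> (\<forall>(u, v)\<in>D. u < v \<and> {u..v} \<subseteq> {a..b}) \<and>
        pairwise (\<lambda>p q. disjnt {fst p<..<snd p} {fst q<..<snd q}) D \<and>
        (\<Sum>(u, v)\<in>D. v - u) < \<delta> \<Longrightarrow> (\<Sum>(u, v)\<in>D. norm (z v - z u)) < ?e * (b - a)"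
      unfolding abs_continuous_on_def by meson
    have Nnull: "N \<in> null_sets lebesgue" using N by (simp add: negligible_iff_null_sets)
    obtain T where T: "open T" "N \<subseteq> T" "T - N \<in> lmeasurable" "emeasure lebesgue (T - N) < ennreal \<delta>"
      using sets_lebesgue_outer_open[of N \<delta>] Nnull \<open>\<delta> > 0\<close> by auto
    have TN: "T = (T - N) \<union> N" using T by auto
    have Tm: "T \<in> lmeasurable"
      using T(3) N by (subst TN) (intro fmeasurable.Un, auto simp: negligible_iff_measure)
    have "measure lebesgue T \<le> measure lebesgue (T - N) + measure lebesgue N"
      by (subst TN) (intro measure_Un_le, use T Nnull in auto)
    also have "measure lebesgue N = 0" using N by (simp add: negligible_imp_measure0)
    also have "measure lebesgue (T - N) < \<delta>"
      using T(3,4) \<open>\<delta> > 0\<close> by (simp add: emeasure_eq_measure2 ennreal_less_iff)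
    finally have mT: "measure lebesgue T < \<delta>" by simp
    have "\<forall>x. \<exists>r>0. x \<in> N \<longrightarrow> ball x r \<subseteq> T"
      using T(1,2) by (meson open_contains_ball subsetD zero_less_one)
    then obtain r where r: "\<And>x. 0 < r x" "\<And>x. x \<in> N \<Longrightarrow> ball x (r x) \<subseteq> T" by metis
    define \<gamma> where "\<gamma> = (\<lambda>x. ball x (if x \<in> N then r x else d x))"
    show "\<exists>\<gamma>. gauge \<gamma> \<and> (\<forall>p. p tagged_division_of {a..b} \<and> \<gamma> fine p \<longrightarrow>
      norm ((\<Sum>(x, K)\<in>p. measure lborel K *\<^sub>R h x) - (z b - z a)) \<le> e * measure lborel {a..b})"
    proof (intro exI[of _ \<gamma>] conjI allI impI)
      show "gauge \<gamma>"
        unfolding \<gamma>_def using d(1) r(1) by (intro gauge_ball_dependent) auto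
      fix p assume "p tagged_division_of {a..b} \<and> \<gamma> fine p"
      then have p: "p tagged_division_of {a..b}" and fine: "\<gamma> fine p" by auto
      note pD = tagged_division_ofD[OF p]
      have ivl: "\<exists>u v. K = {u..v} \<and> u \<le> v \<and> Inf K = u \<and> Sup K = v \<and> x \<in> {u..v} \<and> {u..v} \<subseteq> {a..b}"
        if "(x, K) \<in> p" for x K
        using pD(2-4)[OF that] by force
      have sum1: "b - a = (\<Sum>(x,K)\<in>p. Sup K - Inf K)"
        and sum2: "z b - z a = (\<Sum>(x,K)\<in>p. z (Sup K) - z (Inf K))"
        using additive_tagged_division_1[OF _ p, where f= "\<lambda>x. x"]
          additive_tagged_division_1[OF _ p, where f= z] \<open>a < b\<close> by auto
      let ?good = "\<lambda>(x,K). if x \<in> N then 0 else ?e * (Sup K - Inf K)"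
      let ?bad = "\<lambda>(x,K). if x \<in> N then norm (z (Sup K) - z (Inf K)) else 0"
      have key: "norm (measure lborel K *\<^sub>R h x - (z (Sup K) - z (Inf K))) \<le> ?good (x,K) + ?bad (x,K)"
        if xK: "(x, K) \<in> p" for x K
      proof -
        obtain u v where uv: "K = {u..v}" "u \<le> v" "Inf K = u" "Sup K = v" "x \<in> {u..v}" "{u..v} \<subseteq> {a..b}"
          using ivl[OF xK] by blast
        show ?thesis
        proof (cases "x \<in> N")
          case True
          then show ?thesis by (simp add: h_def norm_minus_commute)
        next
          case False
          have "K \<subseteq> ball x (d x)" using fineD[OF fine xK] False by (simp add: \<gamma>_def)
          then have "u \<in> ball x (d x)" "v \<in> ball x (d x)"
            using uv(1,2) by (metis atLeastAtMost_iff order_refl subsetD)+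
          then have "norm (u - x) < d x" "norm (v - x) < d x" by (auto simp: dist_real_def)
          then have du: "norm (z u - z x - (u-x) *\<^sub>R g x) \<le> ?e * norm (u-x)"
            and dv: "norm (z v - z x - (v-x) *\<^sub>R g x) \<le> ?e * norm (v-x)"
            using d(2)[of x u] d(2)[of x v] uv False by auto
          have "norm ((v - u) *\<^sub>R g x - (z v - z u)) =
              norm (z u - z x - (u - x) *\<^sub>R g x - (z v - z x - (v - x) *\<^sub>R g x))"
            by (auto simp: algebra_simps)
          also have "\<dots> \<le> ?e * norm (u-x) + ?e * norm (v-x)"
            using norm_triangle_ineq4 du dv by (meson add_mono order_trans)
          also have "\<dots> = ?e * (v - u)" using uv(5) by (simp add: field_simps)
          finally show ?thesis using uv False by (simp add: h_def)
        qed
      qed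
      have "norm (\<Sum>(x, K)\<in>p. measure lborel K *\<^sub>R h x - (z (Sup K) - z (Inf K))) \<le> (\<Sum>q\<in>p. ?good q + ?bad q)"
      proof (rule sum_norm_le)
        fix q assume "q \<in> p"
        then show "norm (case q of (x, K) \<Rightarrow> measure lborel K *\<^sub>R h x - (z (Sup K) - z (Inf K))) \<le> ?good q + ?bad q"
          using key[of "fst q" "snd q"] by (simp add: case_prod_unfold)
      qed
      also have "\<dots> = (\<Sum>q\<in>p. ?good q) + (\<Sum>q\<in>p. ?bad q)" by (simp add: sum.distrib)
      also have "(\<Sum>q\<in>p. ?good q) \<le> (\<Sum>q\<in>p. ?e * (case q of (x,K) \<Rightarrow> Sup K - Inf K))"
        using ivl \<open>e > 0\<close> by (intro sum_mono) fastforce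
      also have "\<dots> = ?e * (b - a)" by (simp add: sum1 sum_distrib_left)
      also have "(\<Sum>q\<in>p. ?bad q) \<le> ?e * (b - a)"
      proof -
        \<comment> \<open>Degenerate intervals contribute nothing, and they have to be dropped before tagged
          intervals are replaced by endpoint pairs, which is injective only on nondegenerate ones.\<close>
        define q where "q = {(x,K)\<in>p. x \<in> N \<and> Inf K < Sup K}"
        define E where "E = (\<lambda>(x::real,K::real set). (Inf K, Sup K))"
        have qp: "q \<subseteq> p" by (auto simp: q_def)
        have "finite q" using qp pD(1) finite_subset by blast
        have dj: "disjnt {Inf K<..<Sup K} {Inf L<..<Sup L}"
          if xK: "(x,K) \<in> p" and yL: "(y,L) \<in> p" and ne: "(x,K) \<noteq> (y,L)" for x y K L
          proof -
          obtain u v where "K = {u..v}" "Inf K = u" "Sup K = v" using ivl[OF xK] by blast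
          moreover obtain u' v' where "L = {u'..v'}" "Inf L = u'" "Sup L = v'" using ivl[OF yL] by blast
          ultimately show ?thesis using pD(5)[OF xK yL ne] by (simp only: disjnt_def interior_atLeastAtMost_real)
        qed
        have inj: "inj_on E q"
        proof (rule inj_onI, rule ccontr)
          fix s t assume st: "s \<in> q" "t \<in> q" "E s = E t" "s \<noteq> t"
          obtain x K y L where "s = (x,K)" "t = (y,L)" by fastforce
          with st dj[of x K y L] show False
            by (auto simp: q_def E_def disjnt_def)
        qed
        have "(\<Sum>s\<in>p. ?bad s) = (\<Sum>s\<in>q. ?bad s)"
        proof (rule sum.mono_neutral_right[OF pD(1) qp], rule ballI)
          fix s assume s: "s \<in> p - q"
          obtain x K where sK: "s = (x, K)" by fastforce
          have "Inf K \<le> Sup K" using ivl[of x K] s sK by fastforce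
          then show "?bad s = 0" using s sK by (auto simp: q_def)
        qed
        also have "\<dots> = (\<Sum>(u,v)\<in>E ` q. norm (z v - z u))"
          by (subst sum.reindex[OF inj]) (auto simp: q_def E_def intro!: sum.cong)
        also have "\<dots> < ?e * (b - a)"
        proof (rule \<delta>, intro conjI)
          show "finite (E ` q)" using \<open>finite q\<close> by simp
          show sub: "\<forall>(u,v)\<in>E ` q. u < v \<and> {u..v} \<subseteq> {a..b}"
            using ivl by (force simp: q_def E_def)
          show pw: "pairwise (\<lambda>p q. disjnt {fst p<..<snd p} {fst q<..<snd q}) (E ` q)"
            using dj qp by (fastforce simp: pairwise_def E_def)
          have "(\<Sum>(u, v)\<in>E ` q. v - u) \<le> measure lebesgue T"
          proof (rule sum_disjoint_intervals_le_measure[OF \<open>finite (E ` q)\<close> _ pw Tm])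
            fix u v assume "(u,v) \<in> E ` q"
            then obtain x K where xK: "(x,K) \<in> p" "x \<in> N" "Inf K = u" "Sup K = v" "u < v"
              by (auto simp: q_def E_def)
            have "K \<subseteq> T" using fineD[OF fine xK(1)] xK(2) r(2)[OF xK(2)] by (auto simp: \<gamma>_def)
            then show "u < v \<and> {u..v} \<subseteq> T" using ivl[OF xK(1)] xK by auto
          qed
          then show "(\<Sum>(u, v)\<in>E ` q. v - u) < \<delta>" using mT by simp
        qed
        finally show ?thesis by simp
      qed
      finally show "norm ((\<Sum>(x, K)\<in>p. measure lborel K *\<^sub>R h x) - (z b - z a)) \<le> e * measure lborel {a..b}"
        using \<open>a < b\<close> by (simp add: sum2 sum_subtractf case_prod_unfold)
    qed
  qed
  then show ?thesis
    by (rule has_integral_spike[OF N, rotated]) (auto simp: h_def)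
qed

section \<open>Gronwall's inequality\<close>

lemma gronwall_integral:
  fixes u :: "real \<Rightarrow> real"
  assumes cont: "continuous_on {a..b} u" and t: "t \<in> {a..b}" and "L \<ge> 0"
    and le: "\<And>t. t \<in> {a..b} \<Longrightarrow> u t \<le> A + L * integral {a..t} u"
  shows "u t \<le> A * exp (L * (t - a))"
proof -
  \<comment> \<open>\<open>U\<close> dominates \<open>u\<close>, so \<open>U' = L u \<le> L U\<close> and \<open>G\<close> is nonincreasing.\<close>
  define U where "U = (\<lambda>t. A + L * integral {a..t} u)"
  define G where "G = (\<lambda>t. U t * exp (- L * (t - a)))"
  have dI: "((\<lambda>t. integral {a..t} u) has_real_derivative u x) (at x within {a..b})" if "x \<in> {a..b}" for x
    using integral_has_vector_derivative[OF cont that] by (simp add: has_real_derivative_iff_has_vector_derivative)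
  have dG: "(G has_real_derivative L * (u x - U x) * exp (- L * (x - a))) (at x within {a..b})"
    if "x \<in> {a..b}" for x
    unfolding G_def U_def
    by (rule derivative_eq_intros refl dI that)+ (simp add: algebra_simps)
  have "G t \<le> G a"
  proof (rule DERIV_nonpos_imp_decreasing_open[of a t G])
    show "a \<le> t" using t by simp
    have "continuous_on {a..b} G" by (rule DERIV_continuous_on[OF dG])
    then show "continuous_on {a..t} G" using t by (auto intro: continuous_on_subset)
    fix x assume x: "a < x" "x < t"
    then have "x \<in> {a..b}" "x \<in> interior {a..b}" using t by (auto simp: interior_atLeastAtMost_real)
    then show "\<exists>y. DERIV G x :> y \<and> y \<le> 0"
    proof (intro exI conjI)
      show "DERIV G x :> L * (u x - U x) * exp (- L * (x - a))"
        using dG[OF \<open>x \<in> {a..b}\<close>] at_within_interior[OF \<open>x \<in> interior {a..b}\<close>] by simp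
      have "L * (u x - U x) \<le> 0"
        using le[OF \<open>x \<in> {a..b}\<close>] \<open>L \<ge> 0\<close> by (simp add: U_def mult_nonneg_nonpos)
      then show "L * (u x - U x) * exp (- L * (x - a)) \<le> 0"
        by (rule mult_nonpos_nonneg) simp
    qed
  qed
  then have "U t * exp (- L * (t - a)) \<le> A" by (simp add: G_def U_def)
  then have "U t * exp (- L * (t - a)) * exp (L * (t - a)) \<le> A * exp (L * (t - a))"
    by (rule mult_right_mono) simp
  then have "U t \<le> A * exp (L * (t - a))"
    by (simp add: mult.assoc flip: exp_add)
  then show ?thesis using le[OF t] by (simp add: U_def)
qed

section \<open>The flow of a linear system\<close>

text \<open>
  \<open>flow A t c\<close> is \<open>exp(tA) c\<close>, the value at time \<open>t\<close> of the solution of \<open>x' = A x\<close> that starts in \<open>c\<close>.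
  Each component is given as a real power series in \<open>t\<close>, so that it can be differentiated term by term.
\<close>

definition flow :: "real^'n^'n \<Rightarrow> real \<Rightarrow> real^'n \<Rightarrow> real^'n" where
  "flow A t c = (\<chi> i. \<Sum>k. ((((*v) A ^^ k) c) $ i / fact k) * t ^ k)"

lemma matrix_vector_mult_bound:
  fixes A :: "real^'n^'m"
  obtains L where "L > 0" "\<And>v. norm (A *v v) \<le> L * norm v"
  using bounded_linear.pos_bounded[OF matrix_vector_mul_bounded_linear[of A]]
  by (auto simp: mult.commute)

lemma summable_flow:
  fixes A :: "real^'n^'n"
  shows "summable (\<lambda>k. ((((*v) A ^^ k) c) $ i / fact k) * t ^ k)"
proof -
  obtain L where L: "L > 0" "\<And>v. norm (A *v v) \<le> L * norm v"
    using matrix_vector_mult_bound by blast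
  have pow: "norm (((*v) A ^^ k) c) \<le> L ^ k * norm c" for k
  proof (induction k)
    case (Suc k)
    then show ?case using L(2)[of "((*v) A ^^ k) c"] L(1)
      by (simp add: mult.assoc) (meson mult_left_mono less_imp_le order_trans)
  qed simp
  show ?thesis
  proof (rule summable_comparison_test')
    show "summable (\<lambda>k. norm c * ((L * \<bar>t\<bar>) ^ k /\<^sub>R fact k))"
      by (intro summable_mult summable_exp_generic)
    show "norm (((((*v) A ^^ k) c) $ i / fact k) * t ^ k) \<le> norm c * ((L * \<bar>t\<bar>) ^ k /\<^sub>R fact k)" for k
    proof -
      have "\<bar>(((*v) A ^^ k) c) $ i\<bar> \<le> L ^ k * norm c"
        using component_le_norm_cart pow order_trans by blast
      then have "\<bar>(((*v) A ^^ k) c) $ i\<bar> * (\<bar>t\<bar> ^ k / fact k) \<le> (L ^ k * norm c) * (\<bar>t\<bar> ^ k / fact k)"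
        by (intro mult_right_mono) auto
      then show ?thesis by (simp add: abs_mult power_abs power_mult_distrib field_simps)
    qed
  qed
qed

lemma flow_0: "flow A 0 c = c"
  by (simp only: flow_def vec_eq_iff powser_zero vec_lambda_beta) simp

lemma linear_funpow:
  fixes f :: "'a::real_vector \<Rightarrow> 'a"
  shows "linear f \<Longrightarrow> linear (f ^^ k)"
  by (induction k) (auto simp: linear_id intro: linear_compose)

lemma linear_flow:
  fixes A :: "real^'n^'n"
  shows "linear (flow A t)"
proof (rule linearI)
  fix x y :: "real^'n" and r :: real
  have lin: "linear ((*v) A ^^ k)" for k
    by (intro linear_funpow matrix_vector_mul_linear)
  let ?p = "\<lambda>c i k. ((((*v) A ^^ k) c) $ i / fact k) * t ^ k"
  have "(\<Sum>k. ?p (x + y) i k) = (\<Sum>k. ?p x i k) + (\<Sum>k. ?p y i k)" for i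
    by (subst suminf_add[OF summable_flow summable_flow])
      (simp add: linear_add[OF lin] add_divide_distrib distrib_right)
  then show "flow A t (x + y) = flow A t x + flow A t y"
    by (simp add: flow_def vec_eq_iff)
  have "(\<Sum>k. ?p (r *\<^sub>R x) i k) = r * (\<Sum>k. ?p x i k)" for i
    by (subst suminf_mult[OF summable_flow, symmetric])
      (simp add: linear_scale[OF lin] mult_ac)
  then show "flow A t (r *\<^sub>R x) = r *\<^sub>R flow A t x"
    by (simp add: flow_def vec_eq_iff)
qed

lemma has_vector_derivative_cart:
  fixes f :: "real \<Rightarrow> real^'n"
  assumes "\<And>i. ((\<lambda>t. f t $ i) has_real_derivative f' $ i) (at t within S)"
  shows "(f has_vector_derivative f') (at t within S)"
  unfolding has_vector_derivative_def
  by (subst has_derivative_componentwise_within)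
    (use assms in \<open>auto simp: Basis_vec_def inner_axis has_field_derivative_def mult_commute_abs\<close>)

lemma flow_has_vector_derivative:
  "((\<lambda>t. flow A t c) has_vector_derivative A *v flow A t c) (at t within S)"
proof (rule has_vector_derivative_cart)
  fix i
  let ?c = "\<lambda>i k. (((*v) A ^^ k) c) $ i / fact k"
  have "((\<lambda>t. \<Sum>k. ?c i k * t ^ k) has_field_derivative (\<Sum>k. diffs (?c i) k * t ^ k)) (at t)"
    by (rule termdiffs_strong_converges_everywhere) (rule summable_flow)
  also have "(\<Sum>k. diffs (?c i) k * t ^ k) = (\<Sum>k. \<Sum>j\<in>UNIV. A $ i $ j * (?c j k * t ^ k))"
  proof (intro suminf_cong)
    fix k
    have "diffs (?c i) k = (A *v ((*v) A ^^ k) c) $ i / fact k"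
      by (simp add: diffs_def field_simps del: of_nat_Suc)
    then show "diffs (?c i) k * t ^ k = (\<Sum>j\<in>UNIV. A $ i $ j * (?c j k * t ^ k))"
      by (simp add: matrix_vector_mult_def sum_divide_distrib sum_distrib_right mult.assoc)
  qed
  also have "\<dots> = (\<Sum>j\<in>UNIV. \<Sum>k. A $ i $ j * (?c j k * t ^ k))"
    by (intro suminf_sum summable_mult summable_flow)
  also have "\<dots> = (\<Sum>j\<in>UNIV. A $ i $ j * (\<Sum>k. ?c j k * t ^ k))"
    by (intro sum.cong refl suminf_mult summable_flow)
  also have "\<dots> = (A *v flow A t c) $ i"
    by (simp add: flow_def matrix_vector_mult_def)
  finally show "((\<lambda>t. flow A t c $ i) has_real_derivative (A *v flow A t c) $ i) (at t within S)"
    by (simp add: flow_def has_field_derivative_at_within)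
qed

lemma continuous_on_flow: "continuous_on S (\<lambda>t. flow A t c)"
  using flow_has_vector_derivative by (rule continuous_on_vector_derivative)

section \<open>Observability\<close>

lemma definite_seminorm_bounds_norm:
  fixes p :: "'a::euclidean_space \<Rightarrow> real"
  assumes add: "\<And>x y. p (x + y) \<le> p x + p y" and scale: "\<And>r x. p (r *\<^sub>R x) = \<bar>r\<bar> * p x"
    and def: "\<And>x. p x = 0 \<Longrightarrow> x = 0"
  obtains K where "K > 0" "\<And>x. norm x \<le> K * p x"
proof -
  have p0: "p 0 = 0" using scale[of 0 0] by simp
  have pm: "p (- x) = p x" for x using scale[of "-1" x] by simp
  have nonneg: "p x \<ge> 0" for x using add[of x "-x"] by (simp add: p0 pm)
  have "p (\<Sum>b\<in>B. f b) \<le> (\<Sum>b\<in>B. p (f b))" if "finite B" for B :: "'a set" and f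
    using that by (induction B) (auto simp: p0 intro: order_trans[OF add])
  note psum = this
  define M where "M = (\<Sum>b\<in>Basis. p b)"
  have "M \<ge> 0" by (auto simp: M_def intro: sum_nonneg nonneg)
  have bd: "p x \<le> M * norm x" for x
  proof -
    have "p x = p (\<Sum>b\<in>Basis. (x \<bullet> b) *\<^sub>R b)" by (simp add: euclidean_representation)
    also have "\<dots> \<le> (\<Sum>b\<in>Basis. \<bar>x \<bullet> b\<bar> * p b)" using psum by (metis (no_types, lifting) finite_Basis scale sum.cong)
    also have "\<dots> \<le> (\<Sum>b\<in>Basis. norm x * p b)"
      by (intro sum_mono mult_right_mono nonneg Basis_le_norm)
    finally show ?thesis by (simp add: M_def sum_distrib_left mult.commute)
  qed
  \<comment> \<open>A seminorm is Lipschitz continuous, so a definite one has a positive minimum on the unit sphere.\<close>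
  have lip: "\<bar>p x - p y\<bar> \<le> M * dist x y" for x y
    using add[of "x - y" y] add[of "y - x" x] bd[of "x - y"] bd[of "y - x"]
    by (simp add: dist_norm norm_minus_commute)
  have "M-lipschitz_on UNIV p"
    using lip \<open>M \<ge> 0\<close> by (intro lipschitz_onI) (auto simp: dist_real_def)
  then have "continuous_on UNIV p" by (rule lipschitz_on_continuous_on)
  then have "continuous_on (sphere 0 1) p" by (rule continuous_on_subset) simp
  moreover have "sphere (0::'a) 1 \<noteq> {}" by simp
  ultimately obtain y where y: "y \<in> sphere 0 1" "\<And>x. x \<in> sphere 0 1 \<Longrightarrow> p y \<le> p x"
    using continuous_attains_inf[OF compact_sphere] by blast
  have "p y > 0" using y(1) def[of y] nonneg[of y] by fastforce
  have "norm x \<le> (1 / p y) * p x" for x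
  proof (cases "x = 0")
    case False
    then have "p y \<le> p ((1 / norm x) *\<^sub>R x)" by (intro y(2)) simp
    also have "\<dots> = p x / norm x" by (simp add: scale)
    finally show ?thesis using False \<open>p y > 0\<close> by (simp add: field_simps)
  qed (simp add: p0)
  then show ?thesis using \<open>p y > 0\<close> that[of "1 / p y"] by simp
qed

lemma observability_estimate:
  fixes \<alpha> :: "real^'n^'n" and \<beta> :: "real^'n^'m"
  assumes obs: "completely_observable \<alpha> \<beta>"
  obtains K where "K > 0" "\<And>c. norm c \<le> K * integral {0..1} (\<lambda>t. norm (\<beta> *v flow \<alpha> t c))"
proof -
  define p where "p = (\<lambda>c. integral {0..1} (\<lambda>t. norm (\<beta> *v flow \<alpha> t c)))"
  have cont: "continuous_on S (\<lambda>t. norm (\<beta> *v flow \<alpha> t c))" for c S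
    by (intro continuous_on_norm bounded_linear.continuous_on[OF matrix_vector_mul_bounded_linear]
        continuous_on_flow)
  note int = integrable_continuous_real[OF cont]
  show ?thesis
  proof (rule definite_seminorm_bounds_norm[of p])
    show "p (x + y) \<le> p x + p y" for x y
      unfolding p_def integral_add[OF int int, symmetric]
      by (intro integral_le int integrable_add)
        (auto simp: linear_add[OF linear_flow] matrix_vector_right_distrib norm_triangle_ineq)
    show "p (r *\<^sub>R x) = \<bar>r\<bar> * p x" for r x
      by (simp add: p_def linear_scale[OF linear_flow] matrix_vector_mult_scaleR)
    fix c assume "p c = 0"
    then have "norm (\<beta> *v flow \<alpha> t c) = 0" if "t \<in> {0..1}" for t
      using integral_eq_0_iff[OF cont, of 0 1 c] that by (simp add: p_def)
    then have "\<forall>t\<in>{0<..<1}. \<beta> *v flow \<alpha> t c = 0" by simp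
    moreover have "solves_on {0<..<1} \<alpha> (\<lambda>t. flow \<alpha> t c)"
      by (simp add: solves_on_def flow_has_vector_derivative)
    ultimately have "\<forall>t\<in>{0<..<1}. flow \<alpha> t c = 0"
      using obs[unfolded completely_observable_iff_zero_output] zero_less_one by blast
    then have zero: "flow \<alpha> t c = 0" if "t \<in> {0<..<1}" for t
      using that by blast
    have "flow \<alpha> 0 c = 0"
      by (rule continuous_constant_on_closure[of "{0<..<1}" "\<lambda>t. flow \<alpha> t c", OF continuous_on_flow zero]) auto
    then show "c = 0" by (simp add: flow_0)
  qed (use that p_def in auto)
qed

section \<open>The estimate\<close>

lemma integrable_matrix_vector_mult:
  fixes A :: "real^'n^'m" and w :: "real \<Rightarrow> real^'n"
  assumes "continuous_on {a..b} w"
  shows "(\<lambda>r. A *v w r) integrable_on {a..b}"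
  by (intro integrable_continuous_real assms
      bounded_linear.continuous_on[OF matrix_vector_mul_bounded_linear])

lemma integrable_norm_matrix_vector_mult:
  fixes A :: "real^'n^'m" and w :: "real \<Rightarrow> real^'n"
  assumes "continuous_on {a..b} w"
  shows "(\<lambda>r. norm (A *v w r)) integrable_on {a..b}"
  by (intro integrable_continuous_real continuous_on_norm assms
      bounded_linear.continuous_on[OF matrix_vector_mul_bounded_linear])

lemma linear_integral_equation_bound:
  fixes A :: "real^'n^'n" and w f :: "real \<Rightarrow> real^'n"
  assumes cont: "continuous_on {a..b} w" and f: "f absolutely_integrable_on {a..b}"
    and L: "L \<ge> 0" "\<And>v. norm (A *v v) \<le> L * norm v"
    and eq: "\<And>t. t \<in> {a..b} \<Longrightarrow> w t = c + integral {a..t} (\<lambda>r. A *v w r + f r)"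
    and t: "t \<in> {a..b}"
  shows "norm (w t) \<le> (norm c + integral {a..b} (\<lambda>r. norm (f r))) * exp (L * (t - a))"
proof (rule gronwall_integral[OF _ t \<open>L \<ge> 0\<close>])
  show "continuous_on {a..b} (\<lambda>t. norm (w t))" using cont by (rule continuous_on_norm)
  fix s assume s: "s \<in> {a..b}"
  then have sub: "{a..s} \<subseteq> {a..b}" by auto
  have nf: "(\<lambda>r. norm (f r)) integrable_on {a..b}"
    using f by (simp add: absolutely_integrable_on_def)
  have nfs: "(\<lambda>r. norm (f r)) integrable_on {a..s}" and fs: "f integrable_on {a..s}"
    using integrable_on_subinterval[OF nf sub] f
      integrable_on_subinterval[OF _ sub, of f] by (auto simp: absolutely_integrable_on_def)
  have cs: "continuous_on {a..s} w" using cont sub by (rule continuous_on_subset)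
  have int1: "(\<lambda>r. A *v w r + f r) integrable_on {a..s}"
    by (intro integrable_add fs integrable_matrix_vector_mult cs)
  have int2: "(\<lambda>r. norm (w r)) integrable_on {a..s}"
    by (intro integrable_continuous_real continuous_on_norm cs)
  have "norm (integral {a..s} (\<lambda>r. A *v w r + f r)) \<le> integral {a..s} (\<lambda>r. L * norm (w r) + norm (f r))"
    by (intro integral_norm_bound_integral int1 integrable_add integrable_on_mult_right int2 nfs)
      (meson L(2) add_right_mono norm_triangle_ineq order_trans)
  also have "\<dots> = L * integral {a..s} (\<lambda>r. norm (w r)) + integral {a..s} (\<lambda>r. norm (f r))"
    by (subst integral_add) (auto intro: integrable_on_mult_right int2 nfs)
  also have "integral {a..s} (\<lambda>r. norm (f r)) \<le> integral {a..b} (\<lambda>r. norm (f r))"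
    by (rule integral_subset_le[OF sub nfs nf]) simp
  finally show "norm (w s) \<le> (norm c + integral {a..b} (\<lambda>r. norm (f r))) + L * integral {a..s} (\<lambda>r. norm (w r))"
    using norm_triangle_ineq[of c "integral {a..s} (\<lambda>r. A *v w r + f r)"] eq[OF s] by simp
qed

lemma unit_interval_estimate:
  fixes \<alpha> :: "real^'n^'n" and \<beta> :: "real^'n^'m"
  assumes "completely_observable \<alpha> \<beta>"
  obtains C where "C \<ge> 0"
    "\<And>(s::real) f z. \<lbrakk>continuous_on {s..s+1} z; f absolutely_integrable_on {s..s+1};
        \<And>t. t \<in> {s..s+1} \<Longrightarrow> z t = z s + integral {s..t} (\<lambda>r. \<alpha> *v z r + f r)\<rbrakk>
      \<Longrightarrow> integral {s..s+1} (\<lambda>t. norm (z t)) \<le>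
          C * (integral {s..s+1} (\<lambda>t. norm (\<beta> *v z t)) + integral {s..s+1} (\<lambda>t. norm (f t)))"
proof -
  obtain K where K: "K > 0" "\<And>c. norm c \<le> K * integral {0..1} (\<lambda>t. norm (\<beta> *v flow \<alpha> t c))"
    using observability_estimate[OF assms] by blast
  obtain L where L: "L > 0" "\<And>v. norm (\<alpha> *v v) \<le> L * norm v"
    using matrix_vector_mult_bound by blast
  obtain B where B: "B > 0" "\<And>v. norm (\<beta> *v v) \<le> B * norm v"
    using matrix_vector_mult_bound by blast
  define E where "E = exp L"
  have E: "E > 0" by (simp add: E_def)
  define C where "C = E * K + E * K * B * E + E"
  show ?thesis
  proof (rule that[of C])
    show "C \<ge> 0" using E K(1) B(1) by (simp add: C_def)
    fix s :: real and f z :: "real \<Rightarrow> real^'n"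
    assume cz: "continuous_on {s..s+1} z" and f: "f absolutely_integrable_on {s..s+1}"
      and eq: "\<And>t. t \<in> {s..s+1} \<Longrightarrow> z t = z s + integral {s..t} (\<lambda>r. \<alpha> *v z r + f r)"
    \<comment> \<open>\<open>x\<close> is the free motion with the initial value of \<open>z\<close>, and \<open>w\<close> below is the response to \<open>f\<close> from rest.\<close>
    define x where "x = (\<lambda>t. flow \<alpha> (t - s) (z s))"
    define F where "F = integral {s..s+1} (\<lambda>t. norm (f t))"
    define Y where "Y = integral {s..s+1} (\<lambda>t. norm (\<beta> *v z t))"
    have F: "F \<ge> 0" unfolding F_def by (rule integral_nonneg) (use f in \<open>auto simp: absolutely_integrable_on_def\<close>)
    have Y: "Y \<ge> 0" unfolding Y_def
      by (intro integral_nonneg integrable_norm_matrix_vector_mult cz) simp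
    have dx: "(x has_vector_derivative \<alpha> *v x t) (at t within S)" for t S
    proof -
      have "((\<lambda>t. t - s) has_vector_derivative 1) (at t within S)"
        by (auto intro!: derivative_eq_intros)
      then show ?thesis
        using vector_diff_chain_within[OF _ flow_has_vector_derivative]
        by (fastforce simp: x_def o_def)
    qed
    have cx: "continuous_on S x" for S
      using dx by (rule continuous_on_vector_derivative)
    have x_eq: "x t = z s + integral {s..t} (\<lambda>r. \<alpha> *v x r)" if "t \<in> {s..s+1}" for t
    proof -
      have "((\<lambda>r. \<alpha> *v x r) has_integral x t - x s) {s..t}"
        using that dx by (intro fundamental_theorem_of_calculus) auto
      then show ?thesis by (simp add: x_def flow_0 integral_unique)
    qed
    define w where "w = (\<lambda>t. z t - x t)"
    have cw: "continuous_on {s..s+1} w" unfolding w_def by (intro continuous_intros cz cx)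
    have w_eq: "w t = 0 + integral {s..t} (\<lambda>r. \<alpha> *v w r + f r)" if t: "t \<in> {s..s+1}" for t
    proof -
      have sub: "{s..t} \<subseteq> {s..s+1}" using t by auto
      have "f integrable_on {s..t}"
        using integrable_on_subinterval[OF _ sub] f by (auto simp: absolutely_integrable_on_def)
      then have 1: "(\<lambda>r. \<alpha> *v z r + f r) integrable_on {s..t}"
        by (intro integrable_add integrable_matrix_vector_mult continuous_on_subset[OF cz sub])
      have 2: "(\<lambda>r. \<alpha> *v x r) integrable_on {s..t}"
        by (intro integrable_matrix_vector_mult cx)
      have "w t = integral {s..t} (\<lambda>r. (\<alpha> *v z r + f r) - \<alpha> *v x r)"
        by (subst integral_diff[OF 1 2]) (simp add: w_def eq[OF t] x_eq[OF t])
      then show ?thesis by (simp add: w_def matrix_vector_mult_diff_distrib algebra_simps)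
    qed
    have w_le: "norm (w t) \<le> F * E" if t: "t \<in> {s..s+1}" for t
    proof -
      have "norm (w t) \<le> F * exp (L * (t - s))"
        using linear_integral_equation_bound[OF cw f _ L(2) w_eq t] L(1) by (simp add: F_def)
      also have "\<dots> \<le> F * E" using t L(1) F by (intro mult_left_mono) (auto simp: E_def)
      finally show ?thesis .
    qed
    have x_le: "norm (x t) \<le> norm (z s) * E" if t: "t \<in> {s..s+1}" for t
    proof -
      have "norm (x t) \<le> norm (z s) * exp (L * (t - s))"
        using linear_integral_equation_bound[where f = "\<lambda>_. 0" and a = s and b = "s + 1" and c = "z s", OF cx _ _ L(2) _ t] x_eq L(1)
        by simp
      also have "\<dots> \<le> norm (z s) * E" using t L(1) by (intro mult_left_mono) (auto simp: E_def)
      finally show ?thesis .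
    qed
    have out: "integral {s..s+1} (\<lambda>t. norm (\<beta> *v x t)) \<le> Y + B * (F * E)"
    proof -
      have "integral {s..s+1} (\<lambda>t. norm (\<beta> *v x t)) \<le> integral {s..s+1} (\<lambda>t. norm (\<beta> *v z t) + B * (F * E))"
      proof (intro integral_le integrable_add integrable_norm_matrix_vector_mult cz cx integrable_const_ivl)
        fix t assume t: "t \<in> {s..s+1}"
        have "norm (\<beta> *v x t) = norm (\<beta> *v z t - \<beta> *v w t)"
          by (simp add: w_def matrix_vector_mult_diff_distrib)
        also have "\<dots> \<le> norm (\<beta> *v z t) + norm (\<beta> *v w t)" by (rule norm_triangle_ineq4)
        also have "norm (\<beta> *v w t) \<le> B * (F * E)"
          using B w_le[OF t] by (meson mult_left_mono less_imp_le order_trans)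
        finally show "norm (\<beta> *v x t) \<le> norm (\<beta> *v z t) + B * (F * E)" by simp
      qed
      also have "\<dots> = Y + B * (F * E)"
        unfolding Y_def
        by (subst integral_add) (auto intro!: integrable_norm_matrix_vector_mult cz)
      finally show ?thesis .
    qed
    have "integral {0..1} (\<lambda>t. norm (\<beta> *v flow \<alpha> t (z s))) = integral {s..s+1} (\<lambda>t. norm (\<beta> *v x t))"
    proof -
      have "((\<lambda>t. norm (\<beta> *v x t)) has_integral integral {s..s+1} (\<lambda>t. norm (\<beta> *v x t))) {0+s..1+s}"
        by (simp add: add.commute[of 1] integrable_integral integrable_norm_matrix_vector_mult cx)
      then have "((\<lambda>t. norm (\<beta> *v x t)) \<circ> (+) s has_integral integral {s..s+1} (\<lambda>t. norm (\<beta> *v x t))) {0..1}"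
        by (simp only: has_integral_shift_Icc_real)
      then show ?thesis by (simp add: o_def x_def integral_unique)
    qed
    then have "norm (z s) \<le> K * integral {s..s+1} (\<lambda>t. norm (\<beta> *v x t))"
      using K(2)[of "z s"] by simp
    also have "\<dots> \<le> K * (Y + B * (F * E))"
      by (rule mult_left_mono[OF out]) (use K(1) in simp)
    finally have "norm (z s) \<le> K * (Y + B * (F * E))" .
    then have zs: "norm (z s) * E \<le> K * (Y + B * (F * E)) * E"
      using E by (intro mult_right_mono) auto
    have "integral {s..s+1} (\<lambda>t. norm (z t)) \<le> integral {s..s+1} (\<lambda>t. K * (Y + B * (F * E)) * E + F * E)"
    proof (intro integral_le integrable_continuous_real continuous_on_norm cz continuous_on_const)
      fix t assume t: "t \<in> {s..s+1}"
      have "norm (z t) \<le> norm (x t) + norm (w t)"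
        using norm_triangle_ineq[of "x t" "w t"] by (simp add: w_def)
      then show "norm (z t) \<le> K * (Y + B * (F * E)) * E + F * E"
        using x_le[OF t] w_le[OF t] zs by linarith
    qed
    also have "\<dots> = E * K * Y + (E * K * B * E + E) * F" by (simp add: algebra_simps)
    also have "\<dots> \<le> C * Y + C * F"
      using E K(1) B(1) Y F by (intro add_mono mult_right_mono) (auto simp: C_def)
    finally show "integral {s..s+1} (\<lambda>t. norm (z t)) \<le>
        C * (integral {s..s+1} (\<lambda>t. norm (\<beta> *v z t)) + integral {s..s+1} (\<lambda>t. norm (f t)))"
      by (simp add: Y_def F_def distrib_left)
  qed
qed

lemma integral_le_of_unit_intervals:
  fixes g h :: "real \<Rightarrow> real"
  assumes "\<And>j. j < k \<Longrightarrow> integral {a + real j..a + real j + 1} g \<le> integral {a + real j..a + real j + 1} h"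
    and "g integrable_on {a..a + real k}" "h integrable_on {a..a + real k}"
  shows "integral {a..a + real k} g \<le> integral {a..a + real k} h"
  using assms
proof (induction k)
  case (Suc k)
  have sub: "{a..a + real k} \<subseteq> {a..a + real (Suc k)}" by auto
  have split: "integral {a..a + real k} u + integral {a + real k..a + real k + 1} u = integral {a..a + real (Suc k)} u"
    if "u integrable_on {a..a + real (Suc k)}" for u :: "real \<Rightarrow> real"
    using Henstock_Kurzweil_Integration.integral_combine[OF _ _ that, of "a + real k"] by (simp add: add.assoc add.commute[of 1])
  have "integral {a..a + real k} g \<le> integral {a..a + real k} h"
    using Suc.prems(1) integrable_on_subinterval[OF Suc.prems(2) sub]
      integrable_on_subinterval[OF Suc.prems(3) sub] by (intro Suc.IH) auto
  moreover have "integral {a + real k..a + real k + 1} g \<le> integral {a + real k..a + real k + 1} h"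
    by (rule Suc.prems(1)) simp
  ultimately show ?case
    unfolding split[OF Suc.prems(2), symmetric] split[OF Suc.prems(3), symmetric] by (rule add_mono)
qed simp

text \<open>
  The function \<open>y\<close> is the continuous extension of \<open>z\<close> to those endpoints of \<open>I\<close> that are missing.
\<close>

lemma solves_forced_on_integral_equation:
  fixes \<alpha> :: "real^'n^'n"
  assumes "a < b" and I: "{a<..<b} \<subseteq> I" "I \<subseteq> {a..b}"
    and f: "f absolutely_integrable_on {a..b}" and sol: "solves_forced_on I \<alpha> f z"
  obtains y where "continuous_on {a..b} y" "\<And>t. t \<in> I \<Longrightarrow> y t = z t"
    "\<And>s t. \<lbrakk>a \<le> s; s \<le> t; t \<le> b\<rbrakk> \<Longrightarrow> y t = y s + integral {s..t} (\<lambda>r. \<alpha> *v y r + f r)"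
proof -
  have ac: "abs_continuous_on I z" and der: "AE t in lebesgue. t \<in> I \<longrightarrow>
        (z has_vector_derivative (\<alpha> *v z t + f t)) (at t within I)"
    using sol by (auto simp: solves_forced_on_def)
  have "is_interval I"
    unfolding is_interval_1
  proof (intro ballI allI impI)
    fix u v t assume uv: "u \<in> I" "v \<in> I" "u \<le> t \<and> t \<le> v"
    show "t \<in> I"
    proof (cases "t = u \<or> t = v")
      case False
      have "a \<le> u" "v \<le> b" using uv I(2) by auto
      then have "t \<in> {a<..<b}" using uv(3) False by auto
      then show ?thesis using I(1) by blast
    qed (use uv in auto)
  qed
  then have uc: "uniformly_continuous_on I z"
    using ac abs_continuous_on_imp_uniformly_continuous_on by blast
  have cl: "closure I = {a..b}"
    using closure_mono[OF I(1)] closure_mono[OF I(2)] \<open>a < b\<close> by auto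
  obtain y where y: "uniformly_continuous_on {a..b} y" "\<And>t. t \<in> I \<Longrightarrow> z t = y t"
    using uniformly_continuous_on_extension_on_closure[OF uc] unfolding cl by metis
  have cy: "continuous_on {a..b} y" using y(1) by (rule uniformly_continuous_imp_continuous)
  define g where "g = (\<lambda>r. \<alpha> *v y r + f r)"
  have g: "g integrable_on {a..b}"
    unfolding g_def using f
    by (intro integrable_add integrable_matrix_vector_mult cy)
      (auto simp: absolutely_integrable_on_def)
  have inner: "(g has_integral y t - y s) {s..t}" if st: "s < t" "{s..t} \<subseteq> I" for s t
  proof -
    have "(g has_integral z t - z s) {s..t}"
    proof (rule abs_continuous_on_has_integral[OF st(1) abs_continuous_on_subset[OF ac st(2)]])
      show "AE r in lebesgue. r \<in> {s..t} \<longrightarrow> (z has_vector_derivative g r) (at r within {s..t})"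
        using der
      proof eventually_elim
        case (elim r)
        then show ?case
          using st(2) y(2)[of r] by (auto simp: g_def intro: has_vector_derivative_within_subset)
      qed
    qed
    moreover have "t \<in> I" "s \<in> I" using st by auto
    ultimately show ?thesis by (simp add: y(2))
  qed
  \<comment> \<open>\<open>H\<close> is constant in the open interval, where the equation for \<open>z\<close> is known,
    and by continuity also at the endpoints.\<close>
  define H where "H = (\<lambda>t. y t - integral {a..t} g)"
  have cH: "continuous_on {a..b} H"
    unfolding H_def by (intro continuous_intros cy indefinite_integral_continuous_1 g)
  have comb: "integral {a..s} g + integral {s..t} g = integral {a..t} g" if "a \<le> s" "s \<le> t" "t \<le> b" for s t
    using that by (intro Henstock_Kurzweil_Integration.integral_combine integrable_on_subinterval[OF g]) auto
  have Hlt: "H s = H t" if "a < s" "s < t" "t < b" for s t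
  proof -
    have "{s..t} \<subseteq> I" using that I(1) by auto
    then have "integral {s..t} g = y t - y s" using inner that by (simp add: integral_unique)
    then have "integral {a..t} g = integral {a..s} g + (y t - y s)" using comb[of s t] that by simp
    then show ?thesis by (simp add: H_def)
  qed
  define m where "m = (a + b) / 2"
  have m: "a < m" "m < b" using \<open>a < b\<close> by (auto simp: m_def)
  have Hin: "H t = H m" if "t \<in> {a<..<b}" for t
  proof (cases t m rule: linorder_cases)
    case less then show ?thesis using that m by (intro Hlt) auto
  next
    case greater then show ?thesis using that m by (intro Hlt[symmetric]) auto
  qed simp
  have Hm: "H t = H m" if "t \<in> {a..b}" for t
    by (rule continuous_constant_on_closure[of "{a<..<b}" H]) (use cH that \<open>a < b\<close> in \<open>simp_all add: Hin\<close>)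
  show ?thesis
  proof (rule that[OF cy])
    show "y t = z t" if "t \<in> I" for t using y(2)[OF that] by simp
    fix s t assume st: "a \<le> s" "s \<le> t" "t \<le> b"
    then have "H t = H s" by (simp add: Hm)
    then have "y t - integral {a..t} g = y s - integral {a..s} g" by (simp add: H_def)
    then have "y t = y s + (integral {a..t} g - integral {a..s} g)" by (simp add: algebra_simps)
    also have "integral {a..t} g - integral {a..s} g = integral {s..t} g"
      by (simp flip: comb[OF st])
    finally show "y t = y s + integral {s..t} (\<lambda>r. \<alpha> *v y r + f r)" by (simp add: g_def)
  qed
qed

theorem theoremA1:
  fixes \<alpha> :: "real^'n^'n" and \<beta> :: "real^'n^'m"
  assumes "completely_observable \<alpha> \<beta>"
  shows "\<exists>C::real. \<forall>(I::real set) (a::real) (k::nat) (f::real \<Rightarrow> real^'n) (z::real \<Rightarrow> real^'n).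
           k \<ge> 1 \<and> {a<..<a + real k} \<subseteq> I \<and> I \<subseteq> {a..a + real k} \<and>
           f absolutely_integrable_on I \<and> solves_forced_on I \<alpha> f z
           \<longrightarrow> integral I (\<lambda>t. norm (z t)) \<le>
               C * (integral I (\<lambda>t. norm (\<beta> *v z t)) + integral I (\<lambda>t. norm (f t)))"
proof -
  obtain C where C: "C \<ge> 0"
    "\<And>(s::real) f z. \<lbrakk>continuous_on {s..s+1} z; f absolutely_integrable_on {s..s+1};
        \<And>t. t \<in> {s..s+1} \<Longrightarrow> z t = z s + integral {s..t} (\<lambda>r. \<alpha> *v z r + f r)\<rbrakk>
      \<Longrightarrow> integral {s..s+1} (\<lambda>t. norm (z t)) \<le>
          C * (integral {s..s+1} (\<lambda>t. norm (\<beta> *v z t)) + integral {s..s+1} (\<lambda>t. norm (f t)))"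
    using unit_interval_estimate[OF assms] by blast
  show ?thesis
  proof (intro exI[of _ C] allI impI, elim conjE)
    fix I :: "real set" and a :: real and k :: nat and f z :: "real \<Rightarrow> real^'n"
    assume k: "1 \<le> k" and I: "{a<..<a + real k} \<subseteq> I" "I \<subseteq> {a..a + real k}"
      and fI: "f absolutely_integrable_on I" and sol: "solves_forced_on I \<alpha> f z"
    define b where "b = a + real k"
    have ab: "a < b" using k by (simp add: b_def)
    \<comment> \<open>\<open>I\<close> and its closure differ by a null set, so all integrals may be taken over \<open>{a..b}\<close>.\<close>
    have endpoint: "t = a \<or> t = b" if "t \<in> {a..b} - I" for t
    proof -
      have "t \<notin> {a<..<b}" using that I(1) unfolding b_def by blast
      then show ?thesis using that by auto
    qed
    have neg1: "negligible {t \<in> {a..b} - I. P t}" for P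
      by (rule negligible_subset[of "{a, b}"]) (use endpoint in auto)
    have "I - {a..b} = {}" using I(2) by (simp add: b_def)
    then have neg2: "negligible {t \<in> I - {a..b}. P t}" for P
      by (metis (lifting) empty_iff empty_Collect_eq negligible_empty)
    have f: "f absolutely_integrable_on {a..b}"
      by (rule absolutely_integrable_spike_set[OF fI neg2 neg1])
    obtain y where cy: "continuous_on {a..b} y" and yz: "\<And>t. t \<in> I \<Longrightarrow> y t = z t"
      and y_eq: "\<And>s t. \<lbrakk>a \<le> s; s \<le> t; t \<le> b\<rbrakk> \<Longrightarrow> y t = y s + integral {s..t} (\<lambda>r. \<alpha> *v y r + f r)"
      using solves_forced_on_integral_equation[OF ab I[folded b_def] f sol] by blast
    have int: "integral I h = integral {a..b} h" for h :: "real \<Rightarrow> real"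
      by (rule integral_spike_set[OF neg2 neg1])
    have i1: "(\<lambda>t. norm (y t)) integrable_on {a..b}"
      by (intro integrable_continuous_real continuous_on_norm cy)
    have i2: "(\<lambda>t. norm (\<beta> *v y t)) integrable_on {a..b}"
      by (rule integrable_norm_matrix_vector_mult[OF cy])
    have i3: "(\<lambda>t. norm (f t)) integrable_on {a..b}"
      using f by (simp add: absolutely_integrable_on_def)
    have i4: "(\<lambda>t. C * (norm (\<beta> *v y t) + norm (f t))) integrable_on {a..b}"
      by (intro integrable_on_mult_right integrable_add i2 i3)
    have "integral {a..b} (\<lambda>t. norm (y t)) \<le> integral {a..b} (\<lambda>t. C * (norm (\<beta> *v y t) + norm (f t)))"
      unfolding b_def
    proof (rule integral_le_of_unit_intervals[OF _ i1[unfolded b_def] i4[unfolded b_def]])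
      fix j assume "j < k"
      define s where "s = a + real j"
      have "real j + 1 \<le> real k" using \<open>j < k\<close> by linarith
      then have sub: "{s..s+1} \<subseteq> {a..b}" by (auto simp: s_def b_def)
      have "integral {s..s+1} (\<lambda>t. norm (y t)) \<le>
          C * (integral {s..s+1} (\<lambda>t. norm (\<beta> *v y t)) + integral {s..s+1} (\<lambda>t. norm (f t)))"
      proof (rule C(2))
        show "continuous_on {s..s+1} y" using cy sub by (rule continuous_on_subset)
        show "f absolutely_integrable_on {s..s+1}"
          using f sub by (rule absolutely_integrable_on_subinterval)
        show "y t = y s + integral {s..t} (\<lambda>r. \<alpha> *v y r + f r)" if "t \<in> {s..s+1}" for t
          using that sub by (intro y_eq) auto
      qed
      also have "\<dots> = integral {s..s+1} (\<lambda>t. C * (norm (\<beta> *v y t) + norm (f t)))"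
        using integrable_on_subinterval[OF i2 sub] integrable_on_subinterval[OF i3 sub]
        by (simp add: integral_add)
      finally show "integral {a + real j..a + real j + 1} (\<lambda>t. norm (y t)) \<le>
          integral {a + real j..a + real j + 1} (\<lambda>t. C * (norm (\<beta> *v y t) + norm (f t)))"
        by (simp add: s_def)
    qed
    also have "\<dots> = C * (integral {a..b} (\<lambda>t. norm (\<beta> *v y t)) + integral {a..b} (\<lambda>t. norm (f t)))"
      using i2 i3 by (simp add: integral_add)
    finally have "integral I (\<lambda>t. norm (y t)) \<le>
        C * (integral I (\<lambda>t. norm (\<beta> *v y t)) + integral I (\<lambda>t. norm (f t)))"
      by (simp only: int)
    moreover have "integral I (\<lambda>t. norm (y t)) = integral I (\<lambda>t. norm (z t))"
      "integral I (\<lambda>t. norm (\<beta> *v y t)) = integral I (\<lambda>t. norm (\<beta> *v z t))"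
      using yz by (auto intro!: integral_cong)
    ultimately show "integral I (\<lambda>t. norm (z t)) \<le>
        C * (integral I (\<lambda>t. norm (\<beta> *v z t)) + integral I (\<lambda>t. norm (f t)))"
      by simp
  qed
qed

end
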